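(* For every $t\in\mathbb{N}$ and every $\beta=(\beta_2,\beta_3,\dots,\beta_t)\in\mathbb{C}^{t-1}$, the Leibniz algebra $R(F,2,\beta)$ is complete.
   Context: A Leibniz algebra is an algebra with bilinear product $[\cdot,\cdot]$ satisfying $[a,[b,c]]=[[a,b],c]-[[a,c],b]$ for all $a,b,c$. $R(F,2,\beta)$ is the Leibniz algebra over $\mathbb{C}$ with basis $\{x,y,e_1,e_2,\dots\}$ (elements are finite linear combinations of basis elements) and products $$[e_i,e_1]=e_{i+1}\ (i\ge 2),\quad [e_1,x]=-[x,e_1]=e_1,\quad [e_i,x]=(i-2)e_i+\sum_{k=2}^{t}\beta_k e_{k+i-2}\ (i\ge 2),\quad [e_i,y]=e_i\ (i\ge 2),$$ all other products of basis elements being zero; empty sums are zero. A derivation of $L$ is a linear map $d:L\to L$ with $d([a,b])=[d(a),b]+[a,d(b)]$; it is inner if it equals the right multiplication $b\mapsto[b,a]$ for some $a\in L$. The center is $\{a\in L: [a,b]=[b,a]=0\text{ for all }b\in L\}$. $L$ is complete if its center is zero and all its derivations are inner. *)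

theory Defs
  imports Complex_Main "HOL-Library.Poly_Mapping"
begin

section \<open>(Right) Leibniz algebras\<close>

locale leibniz_algebra = vector_space scale
  for scale :: "'a::field \<Rightarrow> 'b::ab_group_add \<Rightarrow> 'b" +
  fixes bracket :: "'b \<Rightarrow> 'b \<Rightarrow> 'b"
  assumes linear_bracket_left: "Vector_Spaces.linear scale scale (\<lambda>a. bracket a b)"
    and linear_bracket_right: "Vector_Spaces.linear scale scale (\<lambda>b. bracket a b)"
    and leibniz: "bracket a (bracket b c) = bracket (bracket a b) c - bracket (bracket a c) b"
begin

definition derivation :: "('b \<Rightarrow> 'b) \<Rightarrow> bool" where
  "derivation d \<longleftrightarrow> Vector_Spaces.linear scale scale d \<and>
     (\<forall>a b. d (bracket a b) = bracket (d a) b + bracket a (d b))"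

definition inner_derivation :: "('b \<Rightarrow> 'b) \<Rightarrow> bool" where
  "inner_derivation d \<longleftrightarrow> derivation d \<and> (\<exists>a. d = (\<lambda>b. bracket b a))"

definition center :: "'b set" where
  "center = {a. \<forall>b. bracket a b = 0 \<and> bracket b a = 0}"

definition complete :: bool where
  "complete \<longleftrightarrow> center = {0} \<and> (\<forall>d. derivation d \<longrightarrow> inner_derivation d)"

end

section \<open>Finite formal linear combinations over the complex numbers\<close>

definition pm_scale :: "complex \<Rightarrow> ('i \<Rightarrow>\<^sub>0 complex) \<Rightarrow> ('i \<Rightarrow>\<^sub>0 complex)" where
  "pm_scale c v = Poly_Mapping.map ((*) c) v"

definition pm_bilinear ::
  "('i \<Rightarrow> 'i \<Rightarrow> ('i \<Rightarrow>\<^sub>0 complex)) \<Rightarrow> ('i \<Rightarrow>\<^sub>0 complex) \<Rightarrow> ('i \<Rightarrow>\<^sub>0 complex) \<Rightarrow> ('i \<Rightarrow>\<^sub>0 complex)" where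
  "pm_bilinear f a b =
     (\<Sum>i\<in>Poly_Mapping.keys a. \<Sum>j\<in>Poly_Mapping.keys b.
        pm_scale (Poly_Mapping.lookup a i * Poly_Mapping.lookup b j) (f i j))"

lemma lookup_pm_scale [simp]:
  "Poly_Mapping.lookup (pm_scale c v) i = c * Poly_Mapping.lookup v i"
  by (simp add: pm_scale_def Poly_Mapping.map.rep_eq when_def)

lemma vector_space_pm_scale: "vector_space pm_scale"
  by unfold_locales (auto intro!: poly_mapping_eqI simp: lookup_add algebra_simps)

interpretation pm: vector_space pm_scale
  by (rule vector_space_pm_scale)

lemma pm_expand:
  "a = (\<Sum>i\<in>Poly_Mapping.keys a. pm_scale (Poly_Mapping.lookup a i) (Poly_Mapping.single i 1))"
proof (rule poly_mapping_eqI)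
  fix k
  have "(\<Sum>i\<in>Poly_Mapping.keys a. Poly_Mapping.lookup a i * (1 when i = k)) = Poly_Mapping.lookup a k"
    by (cases "k \<in> Poly_Mapping.keys a")
       (auto simp: when_def if_distrib[of "\<lambda>x. _ * x"] in_keys_iff cong: if_cong)
  then show "Poly_Mapping.lookup a k = Poly_Mapping.lookup
      (\<Sum>i\<in>Poly_Mapping.keys a. pm_scale (Poly_Mapping.lookup a i) (Poly_Mapping.single i 1)) k"
    by (simp add: lookup_sum lookup_single)
qed

lemma pm_linearI:
  assumes "\<And>a b. f (a + b) = f a + f b" "\<And>c a. f (pm_scale c a) = pm_scale c (f a)"
  shows "Vector_Spaces.linear pm_scale pm_scale f"
  using assms by unfold_locales

lemma pm_linear_sum:
  assumes "Vector_Spaces.linear pm_scale pm_scale f"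
  shows "f (\<Sum>i\<in>A. g i) = (\<Sum>i\<in>A. f (g i))"
  using assms by (simp add: module_hom_iff_linear[symmetric] module_hom.sum)

lemma pm_linear_eqI:
  assumes f: "Vector_Spaces.linear pm_scale pm_scale f"
    and g: "Vector_Spaces.linear pm_scale pm_scale g"
    and eq: "\<And>i. f (Poly_Mapping.single i 1) = g (Poly_Mapping.single i 1)"
  shows "f a = g a"
proof -
  have sc: "f (pm_scale c v) = pm_scale c (f v)" "g (pm_scale c v) = pm_scale c (g v)" for c v
    using f g by (auto simp: module_hom_iff_linear[symmetric] module_hom.scale)
  show ?thesis
    by (subst (1 2) pm_expand[of a])
       (simp add: pm_linear_sum[OF f] pm_linear_sum[OF g] sc eq)
qed

lemma pm_bilinear_superset:
  assumes "finite A" "finite B" "Poly_Mapping.keys a \<subseteq> A" "Poly_Mapping.keys b \<subseteq> B"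
  shows "pm_bilinear f a b =
    (\<Sum>i\<in>A. \<Sum>j\<in>B. pm_scale (Poly_Mapping.lookup a i * Poly_Mapping.lookup b j) (f i j))"
proof -
  have z: "pm_scale 0 v = 0" for v :: "'a \<Rightarrow>\<^sub>0 complex" by simp
  have "(\<Sum>j\<in>Poly_Mapping.keys b. pm_scale (Poly_Mapping.lookup a i * Poly_Mapping.lookup b j) (f i j))
      = (\<Sum>j\<in>B. pm_scale (Poly_Mapping.lookup a i * Poly_Mapping.lookup b j) (f i j))" for i
    using assms by (intro sum.mono_neutral_left) (auto simp: in_keys_iff)
  then show ?thesis unfolding pm_bilinear_def
    using assms by (simp, intro sum.mono_neutral_left) (auto simp: in_keys_iff)
qed

lemma linear_pm_bilinear_left: "Vector_Spaces.linear pm_scale pm_scale (\<lambda>a. pm_bilinear f a b)"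
proof (rule pm_linearI)
  fix a a' :: "'a \<Rightarrow>\<^sub>0 complex" and c
  let ?A = "Poly_Mapping.keys a \<union> Poly_Mapping.keys a'"
  note s = pm_bilinear_superset[of ?A "Poly_Mapping.keys b" _ b f]
  show "pm_bilinear f (a + a') b = pm_bilinear f a b + pm_bilinear f a' b"
    using keys_add[of a a']
    by (simp add: s lookup_add distrib_right pm.scale_left_distrib sum.distrib)
  show "pm_bilinear f (pm_scale c a) b = pm_scale c (pm_bilinear f a b)"
    by (subst (1 2) pm_bilinear_superset[of "Poly_Mapping.keys a" "Poly_Mapping.keys b"])
       (auto simp: in_keys_iff pm.scale_sum_right mult.assoc)
qed

lemma linear_pm_bilinear_right: "Vector_Spaces.linear pm_scale pm_scale (\<lambda>b. pm_bilinear f a b)"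
proof (rule pm_linearI)
  fix b b' :: "'a \<Rightarrow>\<^sub>0 complex" and c
  let ?B = "Poly_Mapping.keys b \<union> Poly_Mapping.keys b'"
  note s = pm_bilinear_superset[of "Poly_Mapping.keys a" ?B a _ f]
  show "pm_bilinear f a (b + b') = pm_bilinear f a b + pm_bilinear f a b'"
    using keys_add[of b b']
    by (simp add: s lookup_add distrib_left pm.scale_left_distrib sum.distrib)
  show "pm_bilinear f a (pm_scale c b) = pm_scale c (pm_bilinear f a b)"
    by (subst (1 2) pm_bilinear_superset[of "Poly_Mapping.keys a" "Poly_Mapping.keys b"])
       (auto simp: in_keys_iff pm.scale_sum_right mult_ac)
qed

lemma pm_bilinear_single [simp]:
  "pm_bilinear f (Poly_Mapping.single i 1) (Poly_Mapping.single j 1) = f i j"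
  by (simp add: pm_bilinear_def)

section \<open>The algebra \<open>R(F,2,\<beta>)\<close>\<close>

text \<open>The basis is \<open>x, y, e\<^sub>1, e\<^sub>2, \<dots>\<close>. The indices of the \<open>e\<^sub>i\<close> start at 1, so the label
  \<^term>\<open>E n\<close> stands for \<open>e\<^sub>i\<close> with \<open>i = n + 1\<close>.\<close>

datatype R_basis = X | Y | E nat

type_synonym R = "R_basis \<Rightarrow>\<^sub>0 complex"

definition R_x :: R where "R_x = Poly_Mapping.single X 1"
definition R_y :: R where "R_y = Poly_Mapping.single Y 1"

text \<open>Only meant for \<open>i \<ge> 1\<close>.\<close>
definition R_e :: "nat \<Rightarrow> R" where "R_e i = Poly_Mapping.single (E (i - 1)) 1"

text \<open>The tuple \<open>(\<beta>\<^sub>2, \<dots>, \<beta>\<^sub>t)\<close> is given by a function of which only the values at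
  \<open>2, \<dots>, t\<close> are used.\<close>

fun R_table :: "nat \<Rightarrow> (nat \<Rightarrow> complex) \<Rightarrow> R_basis \<Rightarrow> R_basis \<Rightarrow> R" where
  "R_table t \<beta> (E m) (E n) =
     (let i = m + 1; j = n + 1 in if i \<ge> 2 \<and> j = 1 then R_e (i + 1) else 0)"
| "R_table t \<beta> (E m) X =
     (let i = m + 1 in
      if i = 1 then R_e 1
      else pm_scale (of_nat i - 2) (R_e i) + (\<Sum>k = 2..t. pm_scale (\<beta> k) (R_e (k + i - 2))))"
| "R_table t \<beta> (E m) Y = (let i = m + 1 in if i \<ge> 2 then R_e i else 0)"
| "R_table t \<beta> X (E n) = (let j = n + 1 in if j = 1 then - R_e 1 else 0)"
| "R_table t \<beta> X X = 0"
| "R_table t \<beta> X Y = 0"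
| "R_table t \<beta> Y b = 0"

definition R_bracket :: "nat \<Rightarrow> (nat \<Rightarrow> complex) \<Rightarrow> R \<Rightarrow> R \<Rightarrow> R" where
  "R_bracket t \<beta> = pm_bilinear (R_table t \<beta>)"

lemma R_bracket_products:
  "i \<ge> 2 \<Longrightarrow> R_bracket t \<beta> (R_e i) (R_e 1) = R_e (i + 1)"
  "R_bracket t \<beta> (R_e 1) R_x = R_e 1"
  "R_bracket t \<beta> R_x (R_e 1) = - R_e 1"
  "i \<ge> 2 \<Longrightarrow> R_bracket t \<beta> (R_e i) R_x =
     pm_scale (of_nat i - 2) (R_e i) + (\<Sum>k = 2..t. pm_scale (\<beta> k) (R_e (k + i - 2)))"
  "i \<ge> 2 \<Longrightarrow> R_bracket t \<beta> (R_e i) R_y = R_e i"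
  by (auto simp: R_bracket_def R_e_def R_x_def R_y_def Let_def)

lemma R_bracket_zero_products:
  "R_bracket t \<beta> (R_e 1) (R_e 1) = 0"
  "i \<ge> 1 \<Longrightarrow> j \<ge> 2 \<Longrightarrow> R_bracket t \<beta> (R_e i) (R_e j) = 0"
  "R_bracket t \<beta> (R_e 1) R_y = 0"
  "j \<ge> 2 \<Longrightarrow> R_bracket t \<beta> R_x (R_e j) = 0"
  "R_bracket t \<beta> R_x R_x = 0"
  "R_bracket t \<beta> R_x R_y = 0"
  "R_bracket t \<beta> R_y b = 0"
  by (auto simp: R_bracket_def R_e_def R_x_def R_y_def Let_def pm_bilinear_def)

lemma linear_R_bracket_left: "Vector_Spaces.linear pm_scale pm_scale (\<lambda>a. R_bracket t \<beta> a b)"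
  and linear_R_bracket_right: "Vector_Spaces.linear pm_scale pm_scale (\<lambda>b. R_bracket t \<beta> a b)"
  unfolding R_bracket_def by (rule linear_pm_bilinear_left linear_pm_bilinear_right)+

lemma R_bracket_add:
  "R_bracket t \<beta> (a + a') b = R_bracket t \<beta> a b + R_bracket t \<beta> a' b"
  "R_bracket t \<beta> a (b + b') = R_bracket t \<beta> a b + R_bracket t \<beta> a b'"
  by (fact module_hom.add[OF linear_R_bracket_left[folded module_hom_iff_linear]]
      module_hom.add[OF linear_R_bracket_right[folded module_hom_iff_linear]])+

lemma R_bracket_scale:
  "R_bracket t \<beta> (pm_scale c a) b = pm_scale c (R_bracket t \<beta> a b)"
  "R_bracket t \<beta> a (pm_scale c b) = pm_scale c (R_bracket t \<beta> a b)"
  by (fact module_hom.scale[OF linear_R_bracket_left[folded module_hom_iff_linear]]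
      module_hom.scale[OF linear_R_bracket_right[folded module_hom_iff_linear]])+

lemma R_bracket_minus:
  "R_bracket t \<beta> (- a) b = - R_bracket t \<beta> a b"
  "R_bracket t \<beta> a (- b) = - R_bracket t \<beta> a b"
  by (fact module_hom.neg[OF linear_R_bracket_left[folded module_hom_iff_linear]]
      module_hom.neg[OF linear_R_bracket_right[folded module_hom_iff_linear]])+

lemma R_bracket_zero [simp]: "R_bracket t \<beta> 0 b = 0" "R_bracket t \<beta> a 0 = 0"
  by (fact module_hom.zero[OF linear_R_bracket_left[folded module_hom_iff_linear]]
      module_hom.zero[OF linear_R_bracket_right[folded module_hom_iff_linear]])+

lemmas R_bracket_sum =
  pm_linear_sum[OF linear_R_bracket_left] pm_linear_sum[OF linear_R_bracket_right]

lemma R_basis_cases: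
  obtains "Poly_Mapping.single u 1 = R_x" | "Poly_Mapping.single u 1 = R_y"
  | "Poly_Mapping.single u 1 = R_e 1"
  | i where "i \<ge> 2" "Poly_Mapping.single u 1 = R_e i"
proof (cases u)
  case (E n)
  then show ?thesis using that(3) that(4)[of "n + 1"]
    by (cases "n = 0") (auto simp: R_e_def)
qed (use that in \<open>auto simp: R_x_def R_y_def\<close>)

lemma R_leibniz_basis:
  fixes u v w :: R_basis
  defines "a \<equiv> Poly_Mapping.single u 1" and "b \<equiv> Poly_Mapping.single v 1"
    and "c \<equiv> Poly_Mapping.single w 1"
  shows "R_bracket t \<beta> a (R_bracket t \<beta> b c) =
    R_bracket t \<beta> (R_bracket t \<beta> a b) c - R_bracket t \<beta> (R_bracket t \<beta> a c) b"
proof -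
  note [simp] = R_bracket_products R_bracket_zero_products R_bracket_add R_bracket_scale
    R_bracket_minus R_bracket_sum
  have e1: "k \<ge> 2 \<Longrightarrow> i \<ge> 2 \<Longrightarrow> R_bracket t \<beta> (R_e (k + i - 2)) (R_e 1) = R_e (k + i - 1)"
    for k i by (subst R_bracket_products(1)) (auto intro!: arg_cong[of _ _ R_e])
  have ge: "2 \<le> k \<Longrightarrow> 2 \<le> i \<Longrightarrow> 2 \<le> k + i - 2" "2 \<le> i \<Longrightarrow> 1 \<le> i" for k i :: nat
    by auto
  have sc: "pm_scale (of_nat i - 1) z = pm_scale (of_nat i - 2) z + z" for i and z :: R
    by (auto intro!: poly_mapping_eqI simp: lookup_add algebra_simps)
  show ?thesis
    by (rule R_basis_cases[of u]; rule R_basis_cases[of v]; rule R_basis_cases[of w])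
       (simp_all add: a_def b_def c_def e1 ge sc One_nat_def[symmetric] del: One_nat_def cong: sum.cong_simp)
qed

lemma leibniz_algebra_R: "leibniz_algebra pm_scale (R_bracket t \<beta>)"
proof (intro leibniz_algebra.intro vector_space_pm_scale leibniz_algebra_axioms.intro
    linear_R_bracket_left linear_R_bracket_right)
  fix a b c :: R
  let ?B = "R_bracket t \<beta>"
  note lin = R_bracket_add R_bracket_scale pm.scale_right_diff_distrib
  note [simp] = lin
  have 1: "?B (Poly_Mapping.single u 1) (?B (Poly_Mapping.single v 1) c) =
      ?B (?B (Poly_Mapping.single u 1) (Poly_Mapping.single v 1)) c
      - ?B (?B (Poly_Mapping.single u 1) c) (Poly_Mapping.single v 1)" for u v
    by (rule pm_linear_eqI[of _ _ c]; (rule pm_linearI)?)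
       (simp_all add: R_leibniz_basis)
  have 2: "?B (Poly_Mapping.single u 1) (?B b c) =
      ?B (?B (Poly_Mapping.single u 1) b) c - ?B (?B (Poly_Mapping.single u 1) c) b" for u
    by (rule pm_linear_eqI[of _ _ b]; (rule pm_linearI)?) (simp_all add: 1)
  show "?B a (?B b c) = ?B (?B a b) c - ?B (?B a c) b"
    by (rule pm_linear_eqI[of _ _ a]; (rule pm_linearI)?) (simp_all add: 2)
qed

end

theory Submission
  imports Defs
begin

text \<open>
  Write \<open>V\<close> for the span of \<open>e\<^sub>2, e\<^sub>3, \<dots>\<close> and identify it with \<open>\<complex>[z]\<close> through
  \<open>e\<^sub>i = z\<^bsup>i-2\<^esup>\<close>. Only the coordinates of the right factor at \<open>x\<close>, \<open>y\<close> and \<open>e\<^sub>1\<close> enter a product,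
  and on \<open>V\<close> the right multiplications by \<open>e\<^sub>1\<close>, \<open>x\<close>, \<open>y\<close> are \<open>z\<close>, \<open>z d/dz + B(z)\<close> and the
  identity, where \<open>B(z) = \<Sum>\<^sub>k \<beta>\<^sub>k z\<^bsup>k-2\<^esup>\<close>. If \<open>a\<close> is central, the vanishing of \<open>[a,e\<^sub>1]\<close>,
  \<open>[a,x]\<close> and \<open>[a,y]\<close> leaves only a multiple of \<open>y\<close>, and \<open>[e\<^sub>2,a] = 0\<close> kills that.

  For a derivation \<open>d\<close>, comparing coordinates in the defining products gives
  \<open>d e\<^sub>1 = c e\<^sub>1\<close>, \<open>d x = p y + q e\<^sub>1\<close>, \<open>d y = 0\<close> and \<open>d e\<^sub>2 \<in> V\<close>
  (\<open>derivation_on_generators\<close>). Once \<open>g\<close> is chosen to match the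
  coefficient at \<open>e\<^sub>2\<close>, right multiplication by \<open>c x + g y - q e\<^sub>1\<close> agrees with \<open>d\<close> on
  \<open>x\<close>, \<open>y\<close>, \<open>e\<^sub>1\<close>, \<open>e\<^sub>2\<close> up to the term \<open>p y\<close> at \<open>x\<close> and up to an element of the span of
  \<open>e\<^sub>3, e\<^sub>4, \<dots>\<close> at \<open>e\<^sub>2\<close>. The difference \<open>D\<close> is then a derivation with
  \<open>D e\<^sub>1 = 0\<close>, so on \<open>V\<close> it commutes with \<open>z\<close> and is multiplication by the polynomial
  \<open>u = D e\<^sub>2\<close>, with \<open>u(0) = 0\<close>. Applying \<open>D\<close> to the product \<open>[e\<^sub>2,x]\<close>, which is \<open>B\<close>, gives
  \<open>B u = (z u' + B u) + p\<close>; the polynomial \<open>B\<close> cancels, so \<open>z u' + p = 0\<close>, which forces \<open>p = 0\<close> and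
  \<open>u' = 0\<close>. Thus \<open>D\<close> vanishes on \<open>x\<close>, \<open>y\<close>, \<open>e\<^sub>1\<close> and \<open>V\<close>
  (\<open>normalized_derivation_zero\<close>), whatever \<open>B\<close> is, and \<open>d\<close> is inner.
\<close>

section \<open>Right multiplications and differences of derivations\<close>

text \<open>The Leibniz identity says precisely that right multiplications are derivations.\<close>

lemma (in leibniz_algebra) derivation_right_multiplication:
  "derivation (\<lambda>b. bracket b a)"
  unfolding derivation_def using linear_bracket_left leibniz by simp

lemma (in leibniz_algebra) derivation_diff:
  assumes "derivation d" "derivation d'"
  shows "derivation (\<lambda>b. d b - d' b)"
proof -
  have br: "bracket (u - v) w = bracket u w - bracket v w"
    "bracket w (u - v) = bracket w u - bracket w v" for u v w
    using module_hom.diff[OF linear_bracket_left[folded module_hom_iff_linear]]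
      module_hom.diff[OF linear_bracket_right[folded module_hom_iff_linear]] by auto
  have "Vector_Spaces.linear scale scale (\<lambda>b. d b - d' b)"
    using assms unfolding derivation_def module_hom_iff_linear[symmetric]
    by (intro module_pair.module_hom_sub module_pair.intro module_axioms) auto
  then show ?thesis
    using assms unfolding derivation_def by (simp add: br)
qed

section \<open>Products in coordinates\<close>

lemma R_induct [case_names add scale x y e1 e]:
  assumes add: "\<And>a b. P a \<Longrightarrow> P b \<Longrightarrow> P (a + b)"
    and scale: "\<And>c a. P a \<Longrightarrow> P (pm_scale c a)"
    and gens: "P R_x" "P R_y" "P (R_e 1)" "\<And>i. 2 \<le> i \<Longrightarrow> P (R_e i)"
  shows "P a"
proof -
  have basis: "P (Poly_Mapping.single u 1)" for u
    using gens by (cases rule: R_basis_cases[of u]) auto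
  have P0: "P 0"
    using scale[OF gens(1), of 0] by simp
  have "finite A \<Longrightarrow> P (\<Sum>i\<in>A. pm_scale (f i) (Poly_Mapping.single i 1))" for A and f :: "R_basis \<Rightarrow> complex"
    by (induction A rule: finite_induct) (auto intro: P0 add scale basis)
  then show ?thesis
    by (subst pm_expand) simp
qed

lemma lookup_R_e:
  "Poly_Mapping.lookup (R_e i) u = (if u = E (i - 1) then 1 else 0)"
  by (auto simp: R_e_def lookup_single when_def)

lemma lookup_R_x: "Poly_Mapping.lookup R_x u = (if u = X then 1 else 0)"
  by (auto simp: R_x_def lookup_single when_def)

lemma lookup_R_y: "Poly_Mapping.lookup R_y u = (if u = Y then 1 else 0)"
  by (auto simp: R_y_def lookup_single when_def)

lemma R_bracket_diff:
  "R_bracket t \<beta> (a - a') b = R_bracket t \<beta> a b - R_bracket t \<beta> a' b"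
  "R_bracket t \<beta> a (b - b') = R_bracket t \<beta> a b - R_bracket t \<beta> a b'"
  by (simp_all only: diff_conv_add_uminus R_bracket_add R_bracket_minus)

lemmas lookup_R = lookup_R_e lookup_R_x lookup_R_y lookup_add lookup_minus lookup_sum

lemmas R_products = R_bracket_products R_bracket_zero_products R_bracket_zero_products(2)[of 1, simplified]

lemma R_bracket_decompose_right:
  "R_bracket t \<beta> a b =
     pm_scale (Poly_Mapping.lookup b X) (R_bracket t \<beta> a R_x) +
     pm_scale (Poly_Mapping.lookup b Y) (R_bracket t \<beta> a R_y) +
     pm_scale (Poly_Mapping.lookup b (E 0)) (R_bracket t \<beta> a (R_e 1))"
proof (induction b rule: R_induct)
  case (e i)
  have "R_bracket t \<beta> a (R_e i) = 0"
    using e by (induction a rule: R_induct) (auto simp: R_bracket_add R_bracket_scale R_products)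
  then show ?case
    using e by (simp add: lookup_R)
qed (auto simp: lookup_R R_bracket_add R_bracket_scale algebra_simps pm.scale_right_distrib pm.scale_left_distrib)

lemma lookup_R_bracket_e1:
  "Poly_Mapping.lookup (R_bracket t \<beta> a (R_e 1)) X = 0"
  "Poly_Mapping.lookup (R_bracket t \<beta> a (R_e 1)) Y = 0"
  "Poly_Mapping.lookup (R_bracket t \<beta> a (R_e 1)) (E 0) = - Poly_Mapping.lookup a X"
  "Poly_Mapping.lookup (R_bracket t \<beta> a (R_e 1)) (E (Suc 0)) = 0"
  "Poly_Mapping.lookup (R_bracket t \<beta> a (R_e 1)) (E (Suc (Suc n))) = Poly_Mapping.lookup a (E (Suc n))"
  by (induction a rule: R_induct)
    (auto simp: lookup_R R_bracket_add R_bracket_scale R_products simp del: One_nat_def)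

lemma lookup_R_bracket_y:
  "Poly_Mapping.lookup (R_bracket t \<beta> a R_y) X = 0"
  "Poly_Mapping.lookup (R_bracket t \<beta> a R_y) Y = 0"
  "Poly_Mapping.lookup (R_bracket t \<beta> a R_y) (E 0) = 0"
  "Poly_Mapping.lookup (R_bracket t \<beta> a R_y) (E (Suc n)) = Poly_Mapping.lookup a (E (Suc n))"
  by (induction a rule: R_induct)
    (auto simp: lookup_R R_bracket_add R_bracket_scale R_products simp del: One_nat_def)

lemma lookup_R_bracket_x:
  "Poly_Mapping.lookup (R_bracket t \<beta> a R_x) X = 0"
  "Poly_Mapping.lookup (R_bracket t \<beta> a R_x) Y = 0"
  "Poly_Mapping.lookup (R_bracket t \<beta> a R_x) (E 0) = Poly_Mapping.lookup a (E 0)"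
  by (induction a rule: R_induct)
    (auto simp: lookup_R R_bracket_add R_bracket_scale R_products simp del: One_nat_def intro!: sum.neutral)

lemmas lookup_R_bracket = lookup_R_bracket_e1 lookup_R_bracket_x lookup_R_bracket_y

text \<open>On \<open>V\<close> this is multiplication by \<open>z\<close>.\<close>

abbreviation shift :: "nat \<Rightarrow> (nat \<Rightarrow> complex) \<Rightarrow> R \<Rightarrow> R" where
  "shift t \<beta> a \<equiv> R_bracket t \<beta> a (R_e 1)"

lemma linear_shift_power:
  "(shift t \<beta> ^^ m) (a + b) = (shift t \<beta> ^^ m) a + (shift t \<beta> ^^ m) b"
  "(shift t \<beta> ^^ m) (pm_scale c a) = pm_scale c ((shift t \<beta> ^^ m) a)"
  by (induction m) (auto simp: R_bracket_add R_bracket_scale)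

lemma shift_power_R_e: "2 \<le> i \<Longrightarrow> (shift t \<beta> ^^ m) (R_e i) = R_e (i + m)"
  by (induction m) (auto simp: R_products simp del: One_nat_def simp flip: Suc_eq_plus1)

text \<open>On \<open>V\<close> this is the formula \<open>z d/dz + B(z)\<close> for right multiplication by \<open>x\<close>; on \<open>x\<close>, \<open>y\<close> and \<open>e\<^sub>1\<close>
  both sides are zero because the shift sends these into the span of \<open>e\<^sub>1\<close> and so no power of it
  produces a coordinate in \<open>V\<close>. Keeping \<open>B(z)\<close> as a
  polynomial in the shift operator, not expanded into coordinates, is what lets it cancel in
  \<open>normalized_derivation_zero\<close>.\<close>

lemma lookup_R_bracket_x_shift:
  "Poly_Mapping.lookup (R_bracket t \<beta> a R_x) (E (Suc n)) =
     of_nat n * Poly_Mapping.lookup a (E (Suc n)) +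
     (\<Sum>k = 2..t. \<beta> k * Poly_Mapping.lookup ((shift t \<beta> ^^ (k - 2)) a) (E (Suc n)))"
proof (induction a rule: R_induct)
  case (add a b)
  then show ?case
    by (simp add: R_bracket_add lookup_add linear_shift_power algebra_simps sum.distrib del: One_nat_def)
next
  case (scale c a)
  then show ?case
    by (simp add: R_bracket_scale linear_shift_power algebra_simps sum_distrib_left del: One_nat_def)
next
  case x
  have "Poly_Mapping.lookup ((shift t \<beta> ^^ m) R_x) (E (Suc n)) = 0" for m n
    by (induction m arbitrary: n; case_tac n)
       (auto simp: lookup_R lookup_R_bracket simp del: One_nat_def)
  then show ?case by (simp add: R_products lookup_R)
next
  case y
  have "Poly_Mapping.lookup ((shift t \<beta> ^^ m) R_y) (E (Suc n)) = 0" for m n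
    by (induction m arbitrary: n; case_tac n)
       (auto simp: lookup_R lookup_R_bracket simp del: One_nat_def)
  then show ?case by (simp add: R_products lookup_R)
next
  case e1
  have "Poly_Mapping.lookup ((shift t \<beta> ^^ m) (R_e 1)) (E (Suc n)) = 0" for m n
    by (induction m arbitrary: n; case_tac n)
       (auto simp: lookup_R lookup_R_bracket simp del: One_nat_def)
  then show ?case by (simp add: R_products lookup_R del: One_nat_def)
next
  case (e i)
  have "R_bracket t \<beta> (R_e i) R_x = pm_scale (of_nat i - 2) (R_e i) +
      (\<Sum>k = 2..t. pm_scale (\<beta> k) ((shift t \<beta> ^^ (k - 2)) (R_e i)))"
    using e by (simp add: R_products shift_power_R_e add.commute del: One_nat_def)
  moreover have "(of_nat i - 2) * Poly_Mapping.lookup (R_e i) (E (Suc n)) =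
      (of_nat n :: complex) * Poly_Mapping.lookup (R_e i) (E (Suc n))"
    using e by (cases "i = Suc (Suc n)") (auto simp: lookup_R)
  ultimately show ?case
    by (simp add: lookup_add lookup_sum del: One_nat_def)
qed

section \<open>The center\<close>

lemma center_R: "leibniz_algebra.center (R_bracket t \<beta>) = {0}"
proof -
  interpret L: leibniz_algebra pm_scale "R_bracket t \<beta>" by (rule leibniz_algebra_R)
  show ?thesis
  proof (intro set_eqI iffI)
    fix a assume "a \<in> L.center"
    then have left: "\<And>b. R_bracket t \<beta> b a = 0" and right: "\<And>b. R_bracket t \<beta> a b = 0"
      by (auto simp: L.center_def)
    have X: "Poly_Mapping.lookup a X = 0" and E0: "Poly_Mapping.lookup a (E 0) = 0"
      using lookup_R_bracket_e1(3)[of t \<beta> a] lookup_R_bracket_x(3)[of t \<beta> a] right by auto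
    have E: "Poly_Mapping.lookup a (E (Suc n)) = 0" for n
      using lookup_R_bracket_y(4)[of t \<beta> a n] right by auto
    have "Poly_Mapping.lookup a Y = 0"
      using arg_cong[OF R_bracket_decompose_right[of t \<beta> "R_e 2" a], of "\<lambda>v. Poly_Mapping.lookup v (E 1)"]
      by (simp add: X E0 left R_products lookup_R)
    then have "Poly_Mapping.lookup a u = 0" for u
      using X E0 E by (cases u; simp; case_tac x3; simp)
    then show "a \<in> {0}" by (auto intro: poly_mapping_eqI)
  qed (auto simp: L.center_def)
qed

section \<open>Derivations\<close>

text \<open>Each generator is pinned down by applying \<open>d\<close> to products that involve it: \<open>[e\<^sub>1,e\<^sub>1] = 0\<close> and
  \<open>[e\<^sub>1,x] = e\<^sub>1\<close> for \<open>e\<^sub>1\<close>, \<open>[x,e\<^sub>1] = -e\<^sub>1\<close> for \<open>x\<close>, \<open>[y,b] = 0\<close> for \<open>y\<close>, and finally \<open>[e\<^sub>2,y] = e\<^sub>2\<close>.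
  The argument works because multiplication by \<open>z\<close> is injective on \<open>V\<close> and because products
  have no \<open>x\<close>- or \<open>y\<close>-coordinate.\<close>

lemma derivation_on_generators:
  assumes "leibniz_algebra.derivation pm_scale (R_bracket t \<beta>) d"
  obtains c p q where "d (R_e 1) = pm_scale c (R_e 1)"
    "d R_x = pm_scale p R_y + pm_scale q (R_e 1)" "d R_y = 0"
    "Poly_Mapping.lookup (d (R_e 2)) X = 0" "Poly_Mapping.lookup (d (R_e 2)) Y = 0"
    "Poly_Mapping.lookup (d (R_e 2)) (E 0) = 0"
proof -
  interpret L: leibniz_algebra pm_scale "R_bracket t \<beta>" by (rule leibniz_algebra_R)
  let ?l = Poly_Mapping.lookup
  have lin: "Vector_Spaces.linear pm_scale pm_scale d"
    and der: "\<And>a b. d (R_bracket t \<beta> a b) = R_bracket t \<beta> (d a) b + R_bracket t \<beta> a (d b)"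
    using assms by (auto simp: L.derivation_def)
  have d0: "d 0 = 0" and dm: "\<And>v. d (- v) = - d v"
    using lin by (auto simp: module_hom_iff_linear[symmetric] module_hom.zero module_hom.neg)
  have e1: "R_bracket t \<beta> (R_e 1) b = pm_scale (?l b X) (R_e 1)" for b
    by (subst R_bracket_decompose_right) (simp add: R_products del: One_nat_def)
  have x: "R_bracket t \<beta> R_x b = pm_scale (- ?l b (E 0)) (R_e 1)" for b
    by (subst R_bracket_decompose_right) (simp add: R_products del: One_nat_def)
  have ext: "v = w" if "?l v X = ?l w X" "?l v Y = ?l w Y" "?l v (E 0) = ?l w (E 0)"
    "\<And>n. ?l v (E (Suc n)) = ?l w (E (Suc n))" for v w :: R
  proof (rule poly_mapping_eqI)
    fix u show "?l v u = ?l w u" using that by (cases u; simp; case_tac x3; simp)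
  qed
  note [simp] = lookup_R lookup_R_bracket
  note [simp del] = One_nat_def

  \<comment> \<open>The products of \<open>e\<^sub>1\<close> with itself and with \<open>x\<close> determine \<open>d e\<^sub>1\<close> up to a scalar.\<close>
  have e1e1: "R_bracket t \<beta> (d (R_e 1)) (R_e 1) + pm_scale (?l (d (R_e 1)) X) (R_e 1) = 0"
    using der[of "R_e 1" "R_e 1"] by (simp add: R_products d0 e1)
  have e1x: "d (R_e 1) = R_bracket t \<beta> (d (R_e 1)) R_x + pm_scale (?l (d R_x) X) (R_e 1)"
    using der[of "R_e 1" R_x] by (simp add: R_products e1)
  have de1_V: "?l (d (R_e 1)) (E (Suc n)) = 0" for n
    using arg_cong[OF e1e1, of "\<lambda>v. ?l v (E (Suc (Suc n)))"] by simp
  have de1_XY: "?l (d (R_e 1)) X = 0" "?l (d (R_e 1)) Y = 0"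
    by (subst e1x, simp)+
  have dx_X: "?l (d R_x) X = 0"
    using arg_cong[OF e1x, of "\<lambda>v. ?l v (E 0)"] by simp
  have de1: "d (R_e 1) = pm_scale (?l (d (R_e 1)) (E 0)) (R_e 1)"
    by (rule ext) (simp_all add: de1_V de1_XY)

  have xe1: "- d (R_e 1) = R_bracket t \<beta> (d R_x) (R_e 1) + pm_scale (- ?l (d (R_e 1)) (E 0)) (R_e 1)"
    using der[of R_x "R_e 1"] by (simp add: R_products x dm)
  have dx_V: "?l (d R_x) (E (Suc n)) = 0" for n
    using arg_cong[OF xe1, of "\<lambda>v. ?l v (E (Suc (Suc n)))"] by (simp add: de1_V)
  have dx: "d R_x = pm_scale (?l (d R_x) Y) R_y + pm_scale (?l (d R_x) (E 0)) (R_e 1)"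
    by (rule ext) (simp_all add: dx_V dx_X)

  \<comment> \<open>\<open>y\<close> annihilates everything from the left, hence so does \<open>d y\<close>; this leaves only multiples
    of \<open>y\<close>, and \<open>[e\<^sub>2,y] = e\<^sub>2\<close> then excludes the nonzero ones.\<close>
  have ann: "R_bracket t \<beta> (d R_y) b = 0" for b
    using der[of R_y b] by (simp add: R_products d0)
  have dy_X: "?l (d R_y) X = 0" "?l (d R_y) (E (Suc n)) = 0" for n
    using arg_cong[OF ann[of "R_e 1"], of "\<lambda>v. ?l v (E 0)"]
      arg_cong[OF ann[of "R_e 1"], of "\<lambda>v. ?l v (E (Suc (Suc n)))"] by simp_all
  have dy_E0: "?l (d R_y) (E 0) = 0"
    using arg_cong[OF ann[of R_x], of "\<lambda>v. ?l v (E 0)"] by simp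
  have dy: "d R_y = pm_scale (?l (d R_y) Y) R_y"
    by (rule ext) (simp_all add: dy_X dy_E0)
  have e2y: "d (R_e 2) = R_bracket t \<beta> (d (R_e 2)) R_y + pm_scale (?l (d R_y) Y) (R_e 2)"
    using der[of "R_e 2" R_y] dy R_bracket_scale(2) R_bracket_products(5)[of 2] by (metis order_refl)
  have "?l (d R_y) Y = 0"
    using arg_cong[OF e2y, of "\<lambda>v. ?l v (E (Suc 0))"] by (simp add: numeral_2_eq_2)
  with dy have "d R_y = 0" by simp
  moreover have "?l (d (R_e 2)) X = 0" "?l (d (R_e 2)) Y = 0" "?l (d (R_e 2)) (E 0) = 0"
    by (subst e2y, simp)+
  ultimately show ?thesis using that de1 dx by blast
qed

text \<open>The hypotheses describe what remains of a derivation after a suitable right multiplication is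
  subtracted. The term \<open>p y\<close> must be allowed, since \<open>[x,a]\<close> is always a multiple of \<open>e\<^sub>1\<close> and so no
  subtraction can remove it; that \<open>p = 0\<close> only follows from the product \<open>[e\<^sub>2,x]\<close>.\<close>

lemma normalized_derivation_zero:
  assumes "leibniz_algebra.derivation pm_scale (R_bracket t \<beta>) D"
    and De1: "D (R_e 1) = 0" and Dx: "D R_x = pm_scale p R_y" and Dy: "D R_y = 0"
    and De2: "Poly_Mapping.lookup (D (R_e 2)) (E 1) = 0"
  shows "D a = 0"
proof -
  interpret L: leibniz_algebra pm_scale "R_bracket t \<beta>" by (rule leibniz_algebra_R)
  let ?l = Poly_Mapping.lookup
  let ?u = "D (R_e 2)"
  have lin: "Vector_Spaces.linear pm_scale pm_scale D"
    and der: "\<And>a b. D (R_bracket t \<beta> a b) = R_bracket t \<beta> (D a) b + R_bracket t \<beta> a (D b)"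
    using assms(1) by (auto simp: L.derivation_def)
  have Dadd: "\<And>v w. D (v + w) = D v + D w" and Dsc: "\<And>c v. D (pm_scale c v) = pm_scale c (D v)"
    using lin by (auto simp: module_hom_iff_linear[symmetric] module_hom.add module_hom.scale)
  \<comment> \<open>\<open>D\<close> commutes with the shift because \<open>D e\<^sub>1 = 0\<close>.\<close>
  have Dshift: "D ((shift t \<beta> ^^ m) v) = (shift t \<beta> ^^ m) (D v)" for m v
    by (induction m) (simp_all add: der De1 del: One_nat_def)
  have De: "D (R_e i) = (shift t \<beta> ^^ (i - 2)) ?u" if "2 \<le> i" for i
  proof -
    have "(shift t \<beta> ^^ (i - 2)) (R_e 2) = R_e i"
      using shift_power_R_e[of 2 "i - 2" t \<beta>] that by (metis le_add_diff_inverse order_refl)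
    then show ?thesis using Dshift[of "i - 2" "R_e 2"] by metis
  qed
  have "D (R_bracket t \<beta> (R_e 2) R_x) = (\<Sum>k = 2..t. pm_scale (\<beta> k) (D (R_e k)))"
    by (simp add: R_products pm_linear_sum[OF lin] Dsc)
  also have "\<dots> = (\<Sum>k = 2..t. pm_scale (\<beta> k) ((shift t \<beta> ^^ (k - 2)) ?u))"
    by (intro sum.cong refl arg_cong[where f = "pm_scale _"] De) simp
  finally have B: "R_bracket t \<beta> ?u R_x + pm_scale p (R_e 2) =
      (\<Sum>k = 2..t. pm_scale (\<beta> k) ((shift t \<beta> ^^ (k - 2)) ?u))"
    by (simp only: der Dx R_bracket_scale R_bracket_products(5) order_refl)
  \<comment> \<open>Coefficient of \<open>z\<^sup>n\<close> in \<open>z u' + p = 0\<close>.\<close>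
  have key: "of_nat n * ?l ?u (E (Suc n)) + (if n = 0 then p else 0) = 0" for n
    using arg_cong[OF B, of "\<lambda>v. ?l v (E (Suc n))"]
    by (auto simp: lookup_R lookup_R_bracket_x_shift)
  have p: "p = 0" using key[of 0] by simp
  have "?l ?u (E (Suc n)) = 0" for n
    using key[of n] De2 by (cases "n = 0") auto
  moreover have "?l ?u X = 0" "?l ?u Y = 0" "?l ?u (E 0) = 0"
    using derivation_on_generators[OF assms(1)] by metis+
  ultimately have "?l ?u v = 0" for v
    by (cases v; simp; case_tac x3; simp)
  then have u: "?u = 0" by (auto intro: poly_mapping_eqI)
  have "(shift t \<beta> ^^ m) 0 = 0" for m
    by (induction m) auto
  then have "D (R_e i) = 0" if "2 \<le> i" for i
    using De[OF that] u by simp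
  then show ?thesis
    by (induction a rule: R_induct) (simp_all add: Dadd Dsc De1 Dx Dy p del: One_nat_def)
qed

theorem theorem3p11:
  fixes t :: nat and \<beta> :: "nat \<Rightarrow> complex"
  shows "leibniz_algebra.complete pm_scale (R_bracket t \<beta>)"
proof -
  interpret L: leibniz_algebra pm_scale "R_bracket t \<beta>" by (rule leibniz_algebra_R)
  have "L.inner_derivation d" if d: "L.derivation d" for d
  proof -
    obtain c p q where gen: "d (R_e 1) = pm_scale c (R_e 1)"
      "d R_x = pm_scale p R_y + pm_scale q (R_e 1)" "d R_y = 0"
      using derivation_on_generators[OF d] by metis
    \<comment> \<open>The value of \<open>g\<close> makes \<open>d\<close> and right multiplication by \<open>a\<close> agree at the \<open>e\<^sub>2\<close>-coefficient of
      the image of \<open>e\<^sub>2\<close>.\<close>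
    define g where "g = Poly_Mapping.lookup (d (R_e 2)) (E 1)
      - c * Poly_Mapping.lookup (R_bracket t \<beta> (R_e 2) R_x) (E 1)"
    define a where "a = pm_scale c R_x + pm_scale g R_y - pm_scale q (R_e 1)"
    have br: "R_bracket t \<beta> b a = pm_scale c (R_bracket t \<beta> b R_x) + pm_scale g (R_bracket t \<beta> b R_y)
        - pm_scale q (R_bracket t \<beta> b (R_e 1))" for b
      by (simp only: a_def R_bracket_add R_bracket_diff R_bracket_scale)
    have "L.derivation (\<lambda>b. d b - R_bracket t \<beta> b a)"
      by (intro L.derivation_diff d L.derivation_right_multiplication)
    then have "d b - R_bracket t \<beta> b a = 0" for b
    proof (rule normalized_derivation_zero[where p = p])
      show "Poly_Mapping.lookup (d (R_e 2) - R_bracket t \<beta> (R_e 2) a) (E 1) = 0"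
        using lookup_R_bracket_e1(4)[of t \<beta> "R_e 2"]
        by (simp add: br g_def R_products lookup_R lookup_minus)
    qed (simp_all add: br gen R_products del: One_nat_def)
    then have "d = (\<lambda>b. R_bracket t \<beta> b a)" by (simp add: fun_eq_iff)
    with d show ?thesis by (auto simp: L.inner_derivation_def)
  qed
  then show ?thesis by (simp add: L.complete_def center_R)
qed

end
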